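(* Let $R$ be a commutative Noetherian ring and let $N$ be a non-zero finitely generated $R$-module. Then the following conditions are equivalent: (i) For every $N$-proper ideal $\mathfrak{b}$ of $R$, the $\mathfrak{b}$-symbolic topology on $N$ is linearly equivalent to the $\mathfrak{b}$-adic topology on $N$. (ii) $\dim N\leq 1$, and for every $\mathfrak{p}\in\operatorname{Supp}(N)$ the set $\operatorname{Ass}_{R_{\mathfrak{p}}}N_{\mathfrak{p}}$ consists of a single prime ideal.
   Context: An ideal $\mathfrak{b}$ of $R$ is $N$-proper if $N/\mathfrak{b}N\neq 0$. For an ideal $\mathfrak{b}$ and an integer $n\ge 0$, the $n$th symbolic power of $\mathfrak{b}$ with respect to $N$, denoted $(\mathfrak{b}N)^{(n)}$, is the intersection of those primary components of $\mathfrak{b}^nN$ (in a minimal primary decomposition of the submodule $\mathfrak{b}^nN$ of $N$) which correspond to the minimal elements of $\operatorname{Ass}_R N/\mathfrak{b}N$. The $\mathfrak{b}$-adic topology on $N$ is the topology defined by the filtration $\{\mathfrak{b}^nN\}_{n\ge0}$ and the $\mathfrak{b}$-symbolic topology is the one defined by $\{(\mathfrak{b}N)^{(n)}\}_{n\ge 0}$. These two topologies are linearly equivalent if there is an integer $k\ge 0$ such that $(\mathfrak{b}N)^{(n+k)}\subseteq\mathfrak{b}^nN$ for all integers $n\ge 0$. *)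

theory Defs
  imports Complex_Main
begin

text \<open>Commutative rings are types of class comm_ring_1; an R-module N is a type 'b
  of class ab_group_add with a scalar multiplication satisfying the locale module.\<close>

definition is_ideal :: "'a::comm_ring_1 set \<Rightarrow> bool" where
  "is_ideal I \<longleftrightarrow> 0 \<in> I \<and> (\<forall>x\<in>I. \<forall>y\<in>I. x + y \<in> I) \<and> (\<forall>r. \<forall>x\<in>I. r * x \<in> I)"

definition ideal_gen :: "'a::comm_ring_1 set \<Rightarrow> 'a set" where
  "ideal_gen S = \<Inter>{J. is_ideal J \<and> S \<subseteq> J}"

definition prime_ideal :: "'a::comm_ring_1 set \<Rightarrow> bool" where
  "prime_ideal P \<longleftrightarrow> is_ideal P \<and> P \<noteq> UNIV \<and> (\<forall>a b. a * b \<in> P \<longrightarrow> a \<in> P \<or> b \<in> P)"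

definition noetherian_ring :: "'a::comm_ring_1 itself \<Rightarrow> bool" where
  "noetherian_ring _ \<longleftrightarrow> (\<forall>I::'a set. is_ideal I \<longrightarrow> (\<exists>S. finite S \<and> I = ideal_gen S))"

definition fin_gen_module :: "('a::comm_ring_1 \<Rightarrow> 'b::ab_group_add \<Rightarrow> 'b) \<Rightarrow> bool" where
  "fin_gen_module scale \<longleftrightarrow> (\<exists>S. finite S \<and> module.span scale S = UNIV)"

fun ideal_pow :: "'a::comm_ring_1 set \<Rightarrow> nat \<Rightarrow> 'a set" where
  "ideal_pow I 0 = UNIV"
| "ideal_pow I (Suc n) = ideal_gen {a * c | a c. a \<in> I \<and> c \<in> ideal_pow I n}"

definition ideal_smult :: "('a::comm_ring_1 \<Rightarrow> 'b::ab_group_add \<Rightarrow> 'b) \<Rightarrow> 'a set \<Rightarrow> 'b set \<Rightarrow> 'b set" where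
  "ideal_smult scale I L = module.span scale {scale r x | r x. r \<in> I \<and> x \<in> L}"

definition pow_submod :: "('a::comm_ring_1 \<Rightarrow> 'b::ab_group_add \<Rightarrow> 'b) \<Rightarrow> 'a set \<Rightarrow> nat \<Rightarrow> 'b set" where
  "pow_submod scale I n = ideal_smult scale (ideal_pow I n) UNIV"

text \<open>Ass_R (N/L): primes of the form ann_R(x + L) = (L :_R x).\<close>
definition Ass_quot :: "('a::comm_ring_1 \<Rightarrow> 'b::ab_group_add \<Rightarrow> 'b) \<Rightarrow> 'b set \<Rightarrow> 'a set set" where
  "Ass_quot scale L = {P. prime_ideal P \<and> (\<exists>x. P = {r. scale r x \<in> L})}"

definition min_Ass_quot :: "('a::comm_ring_1 \<Rightarrow> 'b::ab_group_add \<Rightarrow> 'b) \<Rightarrow> 'b set \<Rightarrow> 'a set set" where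
  "min_Ass_quot scale L = {P \<in> Ass_quot scale L. \<forall>P' \<in> Ass_quot scale L. P' \<subseteq> P \<longrightarrow> P' = P}"

definition primary_submod :: "('a::comm_ring_1 \<Rightarrow> 'b::ab_group_add \<Rightarrow> 'b) \<Rightarrow> 'b set \<Rightarrow> bool" where
  "primary_submod scale Q \<longleftrightarrow> module.subspace scale Q \<and> Q \<noteq> UNIV \<and>
     (\<forall>r x. scale r x \<in> Q \<longrightarrow> x \<notin> Q \<longrightarrow> (\<exists>n. \<forall>y. scale (r ^ n) y \<in> Q))"

definition primary_prime :: "('a::comm_ring_1 \<Rightarrow> 'b::ab_group_add \<Rightarrow> 'b) \<Rightarrow> 'b set \<Rightarrow> 'a set" where
  "primary_prime scale Q = {r. \<exists>n. \<forall>y. scale (r ^ n) y \<in> Q}"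

definition min_primary_dec :: "('a::comm_ring_1 \<Rightarrow> 'b::ab_group_add \<Rightarrow> 'b) \<Rightarrow> 'b set \<Rightarrow> 'b set set \<Rightarrow> bool" where
  "min_primary_dec scale L D \<longleftrightarrow> finite D \<and> (\<forall>Q\<in>D. primary_submod scale Q) \<and> \<Inter>D = L
     \<and> inj_on (primary_prime scale) D \<and> (\<forall>Q\<in>D. \<Inter>(D - {Q}) \<noteq> L)"

definition symb_power :: "('a::comm_ring_1 \<Rightarrow> 'b::ab_group_add \<Rightarrow> 'b) \<Rightarrow> 'a set \<Rightarrow> nat \<Rightarrow> 'b set" where
  "symb_power scale I n =
     (let D = (SOME D. min_primary_dec scale (pow_submod scale I n) D)
      in \<Inter>{Q \<in> D. primary_prime scale Q \<in> min_Ass_quot scale (pow_submod scale I 1)})"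

definition N_proper :: "('a::comm_ring_1 \<Rightarrow> 'b::ab_group_add \<Rightarrow> 'b) \<Rightarrow> 'a set \<Rightarrow> bool" where
  "N_proper scale I \<longleftrightarrow> pow_submod scale I 1 \<noteq> UNIV"

definition lin_equiv_topologies :: "('a::comm_ring_1 \<Rightarrow> 'b::ab_group_add \<Rightarrow> 'b) \<Rightarrow> 'a set \<Rightarrow> bool" where
  "lin_equiv_topologies scale I \<longleftrightarrow> (\<exists>k. \<forall>n. symb_power scale I (n + k) \<subseteq> pow_submod scale I n)"

text \<open>Supp N = {p prime : N_p \<noteq> 0}; written out: some x/1 \<noteq> 0 in N_p, i.e. ann(x) \<subseteq> p.\<close>
definition Supp :: "('a::comm_ring_1 \<Rightarrow> 'b::ab_group_add \<Rightarrow> 'b) \<Rightarrow> 'a set set" where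
  "Supp scale = {P. prime_ideal P \<and> (\<exists>x. {r. scale r x = 0} \<subseteq> P)}"

definition dim_le_one :: "('a::comm_ring_1 \<Rightarrow> 'b::ab_group_add \<Rightarrow> 'b) \<Rightarrow> bool" where
  "dim_le_one scale \<longleftrightarrow> \<not> (\<exists>P0 P1 P2. P0 \<in> Supp scale \<and> P1 \<in> Supp scale \<and> P2 \<in> Supp scale
      \<and> P0 \<subset> P1 \<and> P1 \<subset> P2)"

text \<open>Ass_{R_p} N_p, described through the bijection q R_p \<leftrightarrow> q between primes of R_p and
  primes q \<subseteq> p of R: q R_p = ann_{R_p}(x/s) iff q is the contraction
  {r. r/1 \<cdot> x/1 = 0 in N_p} = {r. \<exists>u \<notin> p. u r x = 0}.\<close>
definition loc_Ass :: "('a::comm_ring_1 \<Rightarrow> 'b::ab_group_add \<Rightarrow> 'b) \<Rightarrow> 'a set \<Rightarrow> 'a set set" where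
  "loc_Ass scale P = {Q. prime_ideal Q \<and> Q \<subseteq> P \<and>
      (\<exists>x. Q = {r. \<exists>u. u \<notin> P \<and> scale (u * r) x = 0})}"

end

theory Submission
  imports Defs
begin

text \<open>
  The symbolic power \<open>(bN)\<^sup>(\<^sup>n\<^sup>)\<close> is the intersection of the kernels of \<open>N \<rightarrow> (N/b\<^sup>nN)\<^sub>p\<close> over the
  minimal primes \<open>p\<close> of \<open>N/bN\<close>. If the topologies are linearly equivalent for a minimal prime \<open>q\<close> of
  \<open>Supp N\<close>, the kernel of \<open>N \<rightarrow> N\<^sub>q\<close> therefore lies in all \<open>q\<^sup>nN\<close>, hence by Krull's intersection
  theorem in the kernel of \<open>N \<rightarrow> N\<^sub>p\<close> for every prime \<open>p\<close> containing \<open>q\<close>, so that \<open>q\<close> is the only associated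
  prime of \<open>N\<^sub>p\<close>. A chain \<open>P0 \<subset> P1 \<subset> P2\<close> in \<open>Supp N\<close> is excluded by the ideal \<open>a P2\<close> with \<open>a \<in> P1 - P0\<close>:
  its symbolic powers contain \<open>a\<^sup>nN\<close>, its adic powers are \<open>a\<^sup>n P2\<^sup>n N\<close>, and cancelling \<open>a\<^sup>n\<close> at \<open>P2\<close> puts
  \<open>a\<^sup>kN\<close> into every \<open>P2\<^sup>n N\<close> locally at \<open>P2\<close>, against Krull's theorem. Conversely, under (ii) an embedded
  prime \<open>p\<close> of \<open>b\<^sup>nN\<close> strictly contains a prime \<open>q \<supseteq> b\<close> with \<open>Ass N\<^sub>p = {q}\<close>. For \<open>n\<close> large, uniformly in
  \<open>p\<close>, \<open>b\<^sup>n\<close> kills \<open>N\<^sub>p\<close>, so \<open>p\<close> would be associated to \<open>N\<^sub>p\<close>; hence \<open>b\<^sup>nN\<close> has no embedded components.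
\<close>

subsection \<open>Ideals\<close>

lemma module_mult: "module ((*) :: 'a::comm_ring_1 \<Rightarrow> 'a \<Rightarrow> 'a)"
  by unfold_locales (simp_all add: algebra_simps)

lemma is_ideal_iff_subspace: "is_ideal I \<longleftrightarrow> module.subspace (*) I"
  unfolding is_ideal_def module.subspace_def[OF module_mult] by blast

lemma is_ideal_mult_image: "is_ideal J \<Longrightarrow> is_ideal ((*) a ` J)"
  unfolding is_ideal_iff_subspace
  by (rule module_hom.subspace_image[OF module.module_hom_scale_self[OF module_mult]])

lemma ideal_gen_superset: "S \<subseteq> ideal_gen S"
  unfolding ideal_gen_def by blast

lemma ideal_gen_minimal: "S \<subseteq> J \<Longrightarrow> is_ideal J \<Longrightarrow> ideal_gen S \<subseteq> J"
  unfolding ideal_gen_def by blast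

lemma prime_ideal_is_ideal: "prime_ideal P \<Longrightarrow> is_ideal P"
  unfolding prime_ideal_def by blast

lemma prime_ideal_one_notin: "prime_ideal P \<Longrightarrow> 1 \<notin> P"
  unfolding prime_ideal_def is_ideal_def by (metis UNIV_eq_I mult.right_neutral)

lemma prime_ideal_mult_iff: "prime_ideal P \<Longrightarrow> a * b \<in> P \<longleftrightarrow> a \<in> P \<or> b \<in> P"
  unfolding prime_ideal_def is_ideal_def by (metis mult.commute)

lemma prime_ideal_powerD: "prime_ideal P \<Longrightarrow> a ^ n \<in> P \<Longrightarrow> a \<in> P"
  by (induction n) (auto simp: prime_ideal_one_notin prime_ideal_mult_iff)

lemma prime_ideal_diff_notin:
  assumes "prime_ideal P" "u \<notin> P" "c \<in> P"
  shows "u - c \<notin> P"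
  using assms unfolding prime_ideal_def is_ideal_def by (metis diff_add_cancel)

subsection \<open>Submodules\<close>

abbreviation colon :: "('a::comm_ring_1 \<Rightarrow> 'b::ab_group_add \<Rightarrow> 'b) \<Rightarrow> 'b set \<Rightarrow> 'b \<Rightarrow> 'a set" where
  "colon scale L x \<equiv> {r. scale r x \<in> L}"

context module
begin

lemma is_ideal_colon: "subspace L \<Longrightarrow> is_ideal (colon scale L x)"
  unfolding is_ideal_iff_subspace
  by (rule module_hom.subspace_linear_preimage[OF module_hom_scale_left])

lemma colon_subset_colon_scale: "subspace L \<Longrightarrow> colon scale L x \<subseteq> colon scale L (r *s x)"
  using subspace_scale by (auto simp only: scale_left_commute[of _ r])

lemma subspace_vimage_scale: "subspace L \<Longrightarrow> subspace (scale r -` L)"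
  by (rule module_hom.subspace_vimage[OF module_hom_scale_self])

lemma subspace_Union_chain:
  assumes "C \<noteq> {}" "subset.chain \<A> C" and subspace: "\<And>L. L \<in> C \<Longrightarrow> subspace L"
  shows "subspace (\<Union>C)"
proof (rule subspaceI)
  show "0 \<in> \<Union>C" using assms(1) subspace_0[OF subspace] by blast
  show "x + y \<in> \<Union>C" if "x \<in> \<Union>C" "y \<in> \<Union>C" for x y
  proof -
    obtain X Y where XY: "X \<in> C" "x \<in> X" "Y \<in> C" "y \<in> Y" using \<open>x \<in> \<Union>C\<close> \<open>y \<in> \<Union>C\<close> by blast
    then have "X \<subseteq> Y \<or> Y \<subseteq> X" using assms(2) by (auto simp: subset_chain_def)
    then obtain Z where "Z \<in> C" "x \<in> Z" "y \<in> Z" using XY by blast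
    then show ?thesis using subspace_add[OF subspace] by blast
  qed
  show "c *s x \<in> \<Union>C" if "x \<in> \<Union>C" for c x
    using that subspace_scale[OF subspace] by blast
qed

lemma subspace_pow_submod: "subspace (pow_submod scale I n)"
  unfolding pow_submod_def ideal_smult_def by (rule subspace_span)

lemma pow_submod_0 [simp]: "pow_submod scale I 0 = UNIV"
proof -
  have "1 *s x \<in> pow_submod scale I 0" for x
    unfolding pow_submod_def ideal_smult_def ideal_pow.simps by (rule span_base) blast
  then show ?thesis by auto
qed

lemma pow_submod_subset_iff:
  assumes "subspace L"
  shows "pow_submod scale I n \<subseteq> L \<longleftrightarrow> (\<forall>r\<in>ideal_pow I n. \<forall>x. r *s x \<in> L)"
proof
  assume "pow_submod scale I n \<subseteq> L"
  then show "\<forall>r\<in>ideal_pow I n. \<forall>x. r *s x \<in> L"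
    unfolding pow_submod_def ideal_smult_def by (blast intro: span_base)
next
  assume "\<forall>r\<in>ideal_pow I n. \<forall>x. r *s x \<in> L"
  then show "pow_submod scale I n \<subseteq> L"
    unfolding pow_submod_def ideal_smult_def by (intro span_minimal[OF _ assms]) auto
qed

lemma pow_submod_Suc_subset_iff:
  assumes L: "subspace L"
  shows "pow_submod scale I (Suc n) \<subseteq> L \<longleftrightarrow> (\<forall>a\<in>I. \<forall>x\<in>pow_submod scale I n. a *s x \<in> L)"
proof
  assume Suc_subset: "pow_submod scale I (Suc n) \<subseteq> L"
  show "\<forall>a\<in>I. \<forall>x\<in>pow_submod scale I n. a *s x \<in> L"
  proof
    fix a assume "a \<in> I"
    then have "a * c \<in> ideal_pow I (Suc n)" if "c \<in> ideal_pow I n" for c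
      using that ideal_gen_superset[of "{a * c | a c. a \<in> I \<and> c \<in> ideal_pow I n}"] by auto
    then have "(a * c) *s x \<in> L" if "c \<in> ideal_pow I n" for c x
      using that Suc_subset pow_submod_subset_iff[OF L] by blast
    then have "pow_submod scale I n \<subseteq> scale a -` L"
      unfolding pow_submod_subset_iff[OF subspace_vimage_scale[OF L]] by simp
    then show "\<forall>x\<in>pow_submod scale I n. a *s x \<in> L" by blast
  qed
next
  assume scale_mem: "\<forall>a\<in>I. \<forall>x\<in>pow_submod scale I n. a *s x \<in> L"
  have "ideal_pow I (Suc n) \<subseteq> colon scale L x" for x
    unfolding ideal_pow.simps
  proof (rule ideal_gen_minimal[OF _ is_ideal_colon[OF L]], clarify)
    fix a c assume "a \<in> I" "c \<in> ideal_pow I n"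
    then have "a *s c *s x \<in> L"
      using scale_mem pow_submod_subset_iff[OF subspace_pow_submod] by blast
    then show "(a * c) *s x \<in> L" by simp
  qed
  then show "pow_submod scale I (Suc n) \<subseteq> L"
    unfolding pow_submod_subset_iff[OF L] by blast
qed

lemma scale_mem_pow_submod_Suc:
  "a \<in> I \<Longrightarrow> x \<in> pow_submod scale I n \<Longrightarrow> a *s x \<in> pow_submod scale I (Suc n)"
  using pow_submod_Suc_subset_iff[OF subspace_pow_submod] by blast

lemma power_scale_mem_pow_submod: "a \<in> I \<Longrightarrow> a ^ n *s x \<in> pow_submod scale I n"
  by (induction n) (auto dest: scale_mem_pow_submod_Suc)

lemma pow_submod_antimono: "m \<le> n \<Longrightarrow> pow_submod scale I n \<subseteq> pow_submod scale I m"
proof (rule lift_Suc_antimono_le)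
  show "pow_submod scale I (Suc k) \<subseteq> pow_submod scale I k" for k
    unfolding pow_submod_Suc_subset_iff[OF subspace_pow_submod]
    by (blast intro: subspace_scale[OF subspace_pow_submod])
qed

lemma pow_submod_mult_image_subset:
  "pow_submod scale ((*) a ` J) n \<subseteq> scale (a ^ n) ` pow_submod scale J n"
proof (induction n)
  case (Suc n)
  have image_subspace: "subspace (scale (a ^ Suc n) ` pow_submod scale J (Suc n))"
    using module_hom.subspace_image[OF module_hom_scale_self subspace_pow_submod] .
  show ?case
    unfolding pow_submod_Suc_subset_iff[OF image_subspace]
  proof (intro ballI)
    fix b x assume "b \<in> (*) a ` J" "x \<in> pow_submod scale ((*) a ` J) n"
    then obtain j y where "j \<in> J" "b = a * j" "y \<in> pow_submod scale J n" "x = a ^ n *s y"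
      using Suc by blast
    then have "b *s x = a ^ Suc n *s j *s y" "j *s y \<in> pow_submod scale J (Suc n)"
      by (auto simp: algebra_simps intro: scale_mem_pow_submod_Suc)
    then show "b *s x \<in> scale (a ^ Suc n) ` pow_submod scale J (Suc n)" by blast
  qed
qed simp

subsection \<open>Noetherian modules\<close>

lemma span_Un_eq_if_generates_modulo_span:
  assumes "subspace L" "U \<subseteq> L" "L \<subseteq> span (S \<union> U)" "L \<inter> span S = span T"
  shows "span (T \<union> U) = L"
proof
  have "T \<subseteq> L" using span_superset[of T] assms(4) by blast
  then show "span (T \<union> U) \<subseteq> L" using assms(1,2) by (intro span_minimal) auto
  show "L \<subseteq> span (T \<union> U)"
  proof
    fix z assume "z \<in> L"
    then obtain y u where z: "z = y + u" "y \<in> span S" "u \<in> span U"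
      using assms(3) span_Un[of S U] by blast
    have "u \<in> L" using z(3) span_minimal[OF assms(2,1)] by blast
    then have "y \<in> L" using subspace_diff[OF assms(1) \<open>z \<in> L\<close>] z(1) by fastforce
    then have "y \<in> span T" using z(2) assms(4) by blast
    then show "z \<in> span (T \<union> U)" unfolding span_Un using z(1,3) by blast
  qed
qed

lemma finite_lift_of_colon_generators:
  assumes L: "subspace L" "L \<subseteq> span (insert s S)"
    and F: "finite F" "colon scale (span (S \<union> L)) s = ideal_gen F"
  obtains U where "finite U" "U \<subseteq> L" "L \<subseteq> span (S \<union> U)"
proof -
  have span_S: "span S \<subseteq> span (S \<union> X)" for X by (intro span_mono) blast
  have "\<exists>y\<in>span S. \<exists>u\<in>L. f *s s = y + u" if "f \<in> F" for f
  proof -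
    have "f *s s \<in> span (S \<union> L)" using that F(2) ideal_gen_superset by blast
    then show ?thesis unfolding span_Un span_eq_iff[THEN iffD2, OF L(1)] by blast
  qed
  then obtain y u where yu: "\<And>f. f \<in> F \<Longrightarrow> f *s s = y f + u f"
    "\<And>f. f \<in> F \<Longrightarrow> y f \<in> span S" "\<And>f. f \<in> F \<Longrightarrow> u f \<in> L"
    by metis
  have "f *s s \<in> span (S \<union> u ` F)" if "f \<in> F" for f
    unfolding span_Un using yu[OF that] that span_base[of "u f" "u ` F"] by blast
  then have colon_subset: "colon scale (span (S \<union> L)) s \<subseteq> colon scale (span (S \<union> u ` F)) s"
    unfolding F(2) by (intro ideal_gen_minimal is_ideal_colon) auto
  have "L \<subseteq> span (S \<union> u ` F)"
  proof
    fix z assume "z \<in> L"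
    then obtain r where r: "z - r *s s \<in> span S" using L(2) span_breakdown_eq by blast
    have "z \<in> span (S \<union> L)" using \<open>z \<in> L\<close> by (simp add: span_base)
    then have "z - (z - r *s s) \<in> span (S \<union> L)" by (rule span_diff) (use r span_S in blast)
    then have "r *s s \<in> span (S \<union> u ` F)" using colon_subset by auto
    moreover have "z - r *s s \<in> span (S \<union> u ` F)" using r span_S by blast
    ultimately have "z - r *s s + r *s s \<in> span (S \<union> u ` F)" by (rule span_add[rotated])
    then show "z \<in> span (S \<union> u ` F)" by simp
  qed
  moreover have "finite (u ` F)" "u ` F \<subseteq> L" using F(1) yu(3) by auto
  ultimately show thesis by (intro that)
qed

lemma subspace_of_span_fin_gen:
  assumes noetherian: "noetherian_ring TYPE('a)" and "finite S" "subspace L" "L \<subseteq> span S"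
  shows "\<exists>T. finite T \<and> span T = L"
  using assms(2-)
proof (induction S arbitrary: L)
  case empty
  then have "span {} = L" using subspace_0 by auto
  then show ?case by blast
next
  case (insert s S)
  note L = \<open>subspace L\<close>
  obtain F where F: "finite F" "colon scale (span (S \<union> L)) s = ideal_gen F"
    using noetherian is_ideal_colon[OF subspace_span] unfolding noetherian_ring_def by blast
  obtain U where U: "finite U" "U \<subseteq> L" "L \<subseteq> span (S \<union> U)"
    by (rule finite_lift_of_colon_generators[OF L insert.prems(2) F])
  obtain T where T: "finite T" "span T = L \<inter> span S"
    using insert.IH[of "L \<inter> span S"] subspace_inter[OF L subspace_span] by auto
  have "span (T \<union> U) = L"
    using span_Un_eq_if_generates_modulo_span[OF L U(2,3)] T(2) by simp
  moreover have "finite (T \<union> U)" using T(1) U(1) by simp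
  ultimately show ?case by blast
qed

end

locale noetherian_module = module scale
  for scale :: "'a::comm_ring_1 \<Rightarrow> 'b::ab_group_add \<Rightarrow> 'b" (infixr \<open>*s\<close> 75) +
  assumes subspace_fin_gen: "subspace L \<Longrightarrow> \<exists>T. finite T \<and> span T = L"

lemma noetherian_moduleI:
  fixes scale :: "'a::comm_ring_1 \<Rightarrow> 'b::ab_group_add \<Rightarrow> 'b"
  assumes "noetherian_ring TYPE('a)" "module scale" "fin_gen_module scale"
  shows "noetherian_module scale"
proof -
  interpret module scale by (rule assms(2))
  obtain S where S: "finite S" "span S = UNIV" using assms(3) unfolding fin_gen_module_def by blast
  show ?thesis
    by unfold_locales (rule subspace_of_span_fin_gen[OF assms(1) S(1)], simp_all add: S(2))
qed

context noetherian_module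
begin

lemma maximal_subspace:
  assumes "\<A> \<noteq> {}" and subspace: "\<And>L. L \<in> \<A> \<Longrightarrow> subspace L"
  shows "\<exists>M\<in>\<A>. \<forall>X\<in>\<A>. M \<subseteq> X \<longrightarrow> X = M"
proof (rule subset_Zorn_nonempty[OF assms(1)])
  fix C assume C: "C \<noteq> {}" "subset.chain \<A> C"
  have subspace_C: "subspace L" if "L \<in> C" for L
    using that C(2) subspace by (auto simp: subset_chain_def)
  obtain T where T: "finite T" "span T = \<Union>C"
    using subspace_fin_gen[OF subspace_Union_chain[OF C subspace_C]] by blast
  have "T \<subseteq> \<Union>C" using span_superset[of T] T(2) by simp
  then obtain M where M: "M \<in> C" "T \<subseteq> M"
    using finite_subset_Union_chain[OF T(1) _ C] by blast
  have "\<Union>C \<subseteq> M" using span_minimal[OF M(2) subspace_C[OF M(1)]] T(2) by simp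
  then have "\<Union>C = M" using M(1) by blast
  then show "\<Union>C \<in> \<A>" using M(1) C(2) by (auto simp: subset_chain_def)
qed

lemma maximal_subspace_indexed:
  assumes "i \<in> A" "\<And>j. j \<in> A \<Longrightarrow> subspace (f j)"
  obtains j where "j \<in> A" "\<forall>k\<in>A. f j \<subseteq> f k \<longrightarrow> f k = f j"
proof -
  have "\<exists>M\<in>f ` A. \<forall>X\<in>f ` A. M \<subseteq> X \<longrightarrow> X = M"
    using assms by (intro maximal_subspace) auto
  then show thesis unfolding bex_simps ball_simps using that by (rule bexE)
qed

lemma noetherian_induct [consumes 1, case_names step]:
  assumes "subspace L"
    and step: "\<And>L. subspace L \<Longrightarrow> (\<And>X. subspace X \<Longrightarrow> L \<subset> X \<Longrightarrow> P X) \<Longrightarrow> P L"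
  shows "P L"
proof (rule ccontr)
  assume "\<not> P L"
  let ?\<A> = "{X. subspace X \<and> \<not> P X}"
  have "?\<A> \<noteq> {}" using assms(1) \<open>\<not> P L\<close> by blast
  then have "\<exists>M\<in>?\<A>. \<forall>X\<in>?\<A>. M \<subseteq> X \<longrightarrow> X = M" by (rule maximal_subspace) blast
  then obtain M where M: "subspace M" "\<not> P M" "\<forall>X\<in>?\<A>. M \<subseteq> X \<longrightarrow> X = M" by blast
  have "P X" if "subspace X" "M \<subset> X" for X using that M(3) by blast
  then show False using step[OF M(1)] M(2) by blast
qed

end

subsection \<open>Associated primes\<close>

context module
begin

lemma Ass_quot_prime: "p \<in> Ass_quot scale L \<Longrightarrow> prime_ideal p"
  unfolding Ass_quot_def by blast

lemma Ass_quot_subset_Supp: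
  assumes "subspace L"
  shows "Ass_quot scale L \<subseteq> Supp scale"
proof -
  have "{r. r *s x = 0} \<subseteq> colon scale L x" for x using subspace_0[OF assms] by auto
  then show ?thesis unfolding Ass_quot_def Supp_def by blast
qed

lemma Ass_quot_pow_submod_contains:
  assumes "p \<in> Ass_quot scale (pow_submod scale I n)"
  shows "I \<subseteq> p"
proof
  fix a assume "a \<in> I"
  obtain x where p: "prime_ideal p" "p = colon scale (pow_submod scale I n) x"
    using assms unfolding Ass_quot_def by blast
  have "a ^ n \<in> p" unfolding p(2) using power_scale_mem_pow_submod[OF \<open>a \<in> I\<close>] by blast
  then show "a \<in> p" by (rule prime_ideal_powerD[OF p(1)])
qed

lemma colon_span_Un_ideal_multiples:
  assumes L: "subspace L" and J: "is_ideal J" "colon scale L x \<subseteq> J"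
  shows "colon scale (span (L \<union> (\<lambda>r. r *s x) ` J)) x = J"
proof (intro equalityI subsetI)
  fix r assume "r \<in> J"
  then show "r \<in> colon scale (span (L \<union> (\<lambda>r. r *s x) ` J)) x" by (simp add: span_base)
next
  fix r assume "r \<in> colon scale (span (L \<union> (\<lambda>r. r *s x) ` J)) x"
  moreover have "subspace ((\<lambda>r. r *s x) ` J)"
    using module_hom.subspace_image[OF module_hom_scale_left] J(1) unfolding is_ideal_iff_subspace .
  then have "span ((\<lambda>r. r *s x) ` J) = (\<lambda>r. r *s x) ` J" by simp
  ultimately obtain l j where lj: "r *s x = l + j *s x" "l \<in> L" "j \<in> J"
    unfolding span_Un span_eq_iff[THEN iffD2, OF L] by auto
  then have "r - j \<in> J" using J(2) by (auto simp: scale_left_diff_distrib)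
  then have "(r - j) + j \<in> J" using lj(3) J(1) unfolding is_ideal_def by blast
  then show "r \<in> J" by simp
qed

end

context noetherian_module
begin

text \<open>The ring need not be Noetherian, but \<open>R / (L : x)\<close> is a Noetherian ring because
  \<open>(L + R x) / L\<close> is a Noetherian module.\<close>

lemma maximal_ideal_above_colon:
  assumes L: "subspace L" and "J \<in> \<A>"
    and ideals: "\<And>I. I \<in> \<A> \<Longrightarrow> is_ideal I" "\<And>I. I \<in> \<A> \<Longrightarrow> colon scale L x \<subseteq> I"
  obtains M where "M \<in> \<A>" "\<forall>I\<in>\<A>. M \<subseteq> I \<longrightarrow> I = M"
proof -
  let ?f = "\<lambda>I. span (L \<union> (\<lambda>r. r *s x) ` I)"
  obtain M where M: "M \<in> \<A>" "\<forall>I\<in>\<A>. ?f M \<subseteq> ?f I \<longrightarrow> ?f I = ?f M"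
    by (rule maximal_subspace_indexed[of J \<A> ?f, OF \<open>J \<in> \<A>\<close> subspace_span])
  have colon_f: "colon scale (?f I) x = I" if "I \<in> \<A>" for I
    using colon_span_Un_ideal_multiples[OF L ideals(1,2)[OF that]] .
  have "I = M" if "I \<in> \<A>" "M \<subseteq> I" for I
  proof -
    have "?f M \<subseteq> ?f I" using that(2) by (intro span_mono) blast
    then show ?thesis using M that(1) colon_f by metis
  qed
  then show thesis using M(1) that by blast
qed

lemma Ass_quot_colon_scale:
  assumes L: "subspace L" and x: "x \<notin> L"
  obtains r where "r *s x \<notin> L" "colon scale L (r *s x) \<in> Ass_quot scale L"
proof -
  let ?\<A> = "{colon scale L (r *s x) | r. r *s x \<notin> L}"
  have "1 *s x \<notin> L" using x by simp
  then have "colon scale L (1 *s x) \<in> ?\<A>" by blast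
  moreover have "is_ideal I" "colon scale L x \<subseteq> I" if "I \<in> ?\<A>" for I
    using that is_ideal_colon[OF L] colon_subset_colon_scale[OF L] by blast+
  ultimately obtain M where M: "M \<in> ?\<A>" "\<forall>I\<in>?\<A>. M \<subseteq> I \<longrightarrow> I = M"
    by (rule maximal_ideal_above_colon[OF L])
  then obtain r where r: "r *s x \<notin> L" "M = colon scale L (r *s x)" by blast
  have "a \<in> M \<or> b \<in> M" if "a * b \<in> M" for a b
  proof (rule disjCI)
    assume "b \<notin> M"
    then have "colon scale L (b *s r *s x) \<in> ?\<A>" unfolding r(2) by auto
    then have "colon scale L (b *s r *s x) = M"
      unfolding r(2) by (intro M(2)[unfolded r(2), rule_format] colon_subset_colon_scale[OF L])
    moreover have "a \<in> colon scale L (b *s r *s x)"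
      using \<open>a * b \<in> M\<close> unfolding r(2) by (simp add: mult.assoc)
    ultimately show "a \<in> M" by simp
  qed
  moreover have "1 \<notin> M" using r by simp
  ultimately have "prime_ideal M"
    unfolding prime_ideal_def using is_ideal_colon[OF L] r(2) by blast
  then show thesis using that r unfolding Ass_quot_def by blast
qed

lemma Ass_quot_nonempty: "subspace L \<Longrightarrow> L \<noteq> UNIV \<Longrightarrow> Ass_quot scale L \<noteq> {}"
  using Ass_quot_colon_scale by blast

lemma zero_divisor_in_Ass_quot:
  assumes L: "subspace L" and "a *s x \<in> L" "x \<notin> L"
  obtains p where "p \<in> Ass_quot scale L" "a \<in> p"
proof -
  obtain r where "colon scale L (r *s x) \<in> Ass_quot scale L"
    using Ass_quot_colon_scale[OF L \<open>x \<notin> L\<close>] by blast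
  moreover have "a \<in> colon scale L (r *s x)"
    using colon_subset_colon_scale[OF L] \<open>a *s x \<in> L\<close> by blast
  ultimately show thesis by (rule that)
qed

end

subsection \<open>Localisation\<close>

text \<open>\<open>saturation scale P L\<close> is the kernel of \<open>N \<rightarrow> (N/L)\<^sub>P\<close>.\<close>

definition saturation ::
    "('a::comm_ring_1 \<Rightarrow> 'b::ab_group_add \<Rightarrow> 'b) \<Rightarrow> 'a set \<Rightarrow> 'b set \<Rightarrow> 'b set" where
  "saturation scale P L = {x. \<exists>u. u \<notin> P \<and> scale u x \<in> L}"

definition min_Supp ::
    "('a::comm_ring_1 \<Rightarrow> 'b::ab_group_add \<Rightarrow> 'b) \<Rightarrow> 'a set set" where
  "min_Supp scale = {q \<in> Supp scale. \<forall>p\<in>Supp scale. p \<subseteq> q \<longrightarrow> p = q}"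

context module
begin

lemma saturationI: "u \<notin> P \<Longrightarrow> u *s x \<in> L \<Longrightarrow> x \<in> saturation scale P L"
  unfolding saturation_def by blast

lemma notin_saturation_iff: "x \<notin> saturation scale P L \<longleftrightarrow> colon scale L x \<subseteq> P"
  unfolding saturation_def by blast

lemma saturation_mono: "L \<subseteq> L' \<Longrightarrow> saturation scale P L \<subseteq> saturation scale P L'"
  unfolding saturation_def by blast

lemma saturation_superset:
  assumes "prime_ideal P"
  shows "L \<subseteq> saturation scale P L"
  using saturationI[OF prime_ideal_one_notin[OF assms]] by auto

lemma saturation_UNIV [simp]: "prime_ideal P \<Longrightarrow> saturation scale P UNIV = UNIV"
  using saturation_superset by blast

lemma saturation_cancel:
  assumes P: "prime_ideal P" and "u \<notin> P" "u *s x \<in> saturation scale P L"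
  shows "x \<in> saturation scale P L"
proof -
  obtain v where "v \<notin> P" "v *s u *s x \<in> L" using assms(3) unfolding saturation_def by blast
  then show ?thesis
    using prime_ideal_mult_iff[OF P] assms(2) by (intro saturationI[of "v * u"]) auto
qed

lemma saturation_idem:
  assumes "prime_ideal P"
  shows "saturation scale P (saturation scale P L) = saturation scale P L"
proof
  have "u \<notin> P \<Longrightarrow> u *s x \<in> saturation scale P L \<Longrightarrow> x \<in> saturation scale P L" for u x
    by (rule saturation_cancel[OF assms])
  then show "saturation scale P (saturation scale P L) \<subseteq> saturation scale P L"
    unfolding saturation_def[of _ _ "saturation scale P L"] by blast
qed (rule saturation_superset[OF assms])

lemma saturation_Int:
  assumes P: "prime_ideal P" and "subspace A" "subspace B"
  shows "saturation scale P (A \<inter> B) = saturation scale P A \<inter> saturation scale P B"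
proof
  show "saturation scale P A \<inter> saturation scale P B \<subseteq> saturation scale P (A \<inter> B)"
  proof
    fix x assume "x \<in> saturation scale P A \<inter> saturation scale P B"
    then obtain u v where uv: "u \<notin> P" "u *s x \<in> A" "v \<notin> P" "v *s x \<in> B"
      unfolding saturation_def by blast
    then have "v *s u *s x \<in> A" "u *s v *s x \<in> B" using assms(2,3) subspace_scale by blast+
    then have "(u * v) *s x \<in> A \<inter> B" by (simp add: mult.commute)
    then show "x \<in> saturation scale P (A \<inter> B)"
      using prime_ideal_mult_iff[OF P] uv(1,3) by (intro saturationI[of "u * v"]) auto
  qed
qed (simp_all add: saturation_mono)

lemma saturation_Inter:
  assumes P: "prime_ideal P" and "finite D" "\<And>L. L \<in> D \<Longrightarrow> subspace L"
  shows "saturation scale P (\<Inter>D) = (\<Inter>L\<in>D. saturation scale P L)"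
  using assms(2,3)
proof (induction D)
  case (insert L D)
  then show ?case by (simp add: saturation_Int[OF P] subspace_Inter)
qed (simp add: P)

lemma subspace_saturation:
  assumes P: "prime_ideal P" and L: "subspace L"
  shows "subspace (saturation scale P L)"
proof (rule subspaceI)
  show "0 \<in> saturation scale P L" using saturation_superset[OF P] subspace_0[OF L] by blast
next
  fix x y assume "x \<in> saturation scale P L" "y \<in> saturation scale P L"
  then obtain u v where uv: "u \<notin> P" "u *s x \<in> L" "v \<notin> P" "v *s y \<in> L"
    unfolding saturation_def by blast
  then have "v *s u *s x + u *s v *s y \<in> L" using subspace_add[OF L] subspace_scale[OF L] by blast
  then have "(u * v) *s (x + y) \<in> L" by (simp add: scale_right_distrib mult.commute)
  then show "x + y \<in> saturation scale P L"
    using prime_ideal_mult_iff[OF P] uv(1,3) by (intro saturationI[of "u * v"]) auto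
next
  fix c x assume "x \<in> saturation scale P L"
  then obtain u where "u \<notin> P" "u *s x \<in> L" unfolding saturation_def by blast
  then have "u *s c *s x \<in> L" using subspace_scale[OF L, of "u *s x" c] by (simp add: mult.commute)
  then show "c *s x \<in> saturation scale P L" by (rule saturationI[OF \<open>u \<notin> P\<close>])
qed

text \<open>Nakayama's lemma for the cyclic module generated by \<open>x\<close> over the local ring \<open>R\<^sub>P\<close>.\<close>

lemma saturation_span_insert_scale:
  assumes P: "prime_ideal P" and L: "subspace L" and "a \<in> P"
    and x: "x \<in> saturation scale P (span (insert (a *s x) L))"
  shows "x \<in> saturation scale P L"
proof -
  obtain u where u: "u \<notin> P" "u *s x \<in> span (insert (a *s x) L)"
    using x unfolding saturation_def by blast
  then obtain r where "u *s x - r *s a *s x \<in> L"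
    using span_breakdown_eq span_eq_iff[THEN iffD2, OF L] by blast
  then have "(u - r * a) *s x \<in> L" by (simp add: scale_left_diff_distrib)
  moreover have "u - r * a \<notin> P"
    using prime_ideal_diff_notin[OF P u(1)] \<open>a \<in> P\<close> prime_ideal_mult_iff[OF P] by blast
  ultimately show ?thesis by (rule saturationI[rotated])
qed

lemma Supp_iff_saturation: "P \<in> Supp scale \<longleftrightarrow> prime_ideal P \<and> saturation scale P {0} \<noteq> UNIV"
  unfolding Supp_def saturation_def by blast

lemma Supp_prime: "P \<in> Supp scale \<Longrightarrow> prime_ideal P"
  unfolding Supp_def by blast

end

context noetherian_module
begin

lemma saturation_uniform:
  assumes P: "prime_ideal P" and L: "subspace L"
  obtains u where "u \<notin> P" "saturation scale P L = scale u -` L"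
proof -
  obtain u where u: "u \<in> - P"
    "\<forall>v\<in>- P. scale u -` L \<subseteq> scale v -` L \<longrightarrow> scale v -` L = scale u -` L"
    by (rule maximal_subspace_indexed[of 1 "- P" "\<lambda>u. scale u -` L"])
      (simp_all add: prime_ideal_one_notin[OF P] subspace_vimage_scale[OF L])
  have "x \<in> scale u -` L" if "v \<notin> P" "v *s x \<in> L" for v x
  proof -
    have "scale u -` L \<subseteq> scale (v * u) -` L"
      using subspace_scale[OF L] by (auto simp flip: scale_scale)
    then have "scale (v * u) -` L = scale u -` L"
      using u that(1) prime_ideal_mult_iff[OF P] by simp
    moreover have "x \<in> scale (v * u) -` L"
      using subspace_scale[OF L that(2), of u] by (simp add: mult.commute)
    ultimately show ?thesis by simp
  qed
  then have "saturation scale P L \<subseteq> scale u -` L" unfolding saturation_def by blast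
  moreover have "scale u -` L \<subseteq> saturation scale P L" using saturationI[of u] u(1) by blast
  ultimately show thesis using that[of u] u(1) by simp
qed

lemma Ass_quot_saturation:
  assumes P: "prime_ideal P" and L: "subspace L"
  shows "Ass_quot scale (saturation scale P L) = {p \<in> Ass_quot scale L. p \<subseteq> P}"
proof (intro equalityI subsetI)
  fix p assume "p \<in> Ass_quot scale (saturation scale P L)"
  then obtain x where p: "prime_ideal p" "p = colon scale (saturation scale P L) x"
    unfolding Ass_quot_def by blast
  obtain u where u: "saturation scale P L = scale u -` L"
    using saturation_uniform[OF P L] by blast
  have "p = colon scale L (u *s x)" unfolding p(2) u by (simp add: mult.commute)
  moreover have "x \<notin> saturation scale P L" using prime_ideal_one_notin[OF p(1)] p(2) by simp
  then have "p \<subseteq> P" unfolding p(2) using saturation_cancel[OF P] by blast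
  ultimately show "p \<in> {p \<in> Ass_quot scale L. p \<subseteq> P}" using p(1) unfolding Ass_quot_def by blast
next
  fix p assume "p \<in> {p \<in> Ass_quot scale L. p \<subseteq> P}"
  then obtain x where p: "prime_ideal p" "p \<subseteq> P" "p = colon scale L x"
    unfolding Ass_quot_def by blast
  have "colon scale (saturation scale P L) x \<subseteq> p"
  proof
    fix r assume "r \<in> colon scale (saturation scale P L) x"
    then obtain u where "u \<notin> P" "u * r \<in> p" unfolding p(3) saturation_def by auto
    then show "r \<in> p" using p(2) prime_ideal_mult_iff[OF p(1)] by blast
  qed
  moreover have "p \<subseteq> colon scale (saturation scale P L) x"
    unfolding p(3) using saturation_superset[OF P] by blast
  ultimately show "p \<in> Ass_quot scale (saturation scale P L)"
    using p(1) unfolding Ass_quot_def by blast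
qed

lemma Ass_quot_below:
  assumes "prime_ideal P" "subspace L" "saturation scale P L \<noteq> UNIV"
  obtains p where "p \<in> Ass_quot scale L" "p \<subseteq> P"
proof -
  have "Ass_quot scale (saturation scale P L) \<noteq> {}"
    by (rule Ass_quot_nonempty[OF subspace_saturation[OF assms(1,2)] assms(3)])
  then show thesis unfolding Ass_quot_saturation[OF assms(1,2)] using that by blast
qed

lemma Supp_Ass_below:
  assumes "P \<in> Supp scale"
  obtains p where "p \<in> Ass_quot scale {0}" "p \<subseteq> P"
proof -
  have "prime_ideal P" "saturation scale P {0} \<noteq> UNIV" using assms Supp_iff_saturation by auto
  then show thesis using that by (rule Ass_quot_below[OF _ subspace_single_0])
qed

lemma loc_Ass_eq_Ass_quot_saturation:
  assumes "prime_ideal P"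
  shows "loc_Ass scale P = Ass_quot scale (saturation scale P {0})"
proof -
  have "loc_Ass scale P = {p \<in> Ass_quot scale (saturation scale P {0}). p \<subseteq> P}"
    unfolding loc_Ass_def Ass_quot_def saturation_def by auto
  then show ?thesis unfolding Ass_quot_saturation[OF assms subspace_single_0] by blast
qed

lemma loc_Ass_eq: "prime_ideal P \<Longrightarrow> loc_Ass scale P = {p \<in> Ass_quot scale {0}. p \<subseteq> P}"
  by (simp add: loc_Ass_eq_Ass_quot_saturation Ass_quot_saturation)

lemma Inter_saturation_Ass_quot:
  assumes L: "subspace L"
  shows "(\<Inter>p\<in>Ass_quot scale L. saturation scale p L) = L"
proof
  show "L \<subseteq> (\<Inter>p\<in>Ass_quot scale L. saturation scale p L)"
    using saturation_superset Ass_quot_prime by blast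
  show "(\<Inter>p\<in>Ass_quot scale L. saturation scale p L) \<subseteq> L"
  proof (rule ccontr)
    assume "\<not> (\<Inter>p\<in>Ass_quot scale L. saturation scale p L) \<subseteq> L"
    then obtain x where x: "x \<in> (\<Inter>p\<in>Ass_quot scale L. saturation scale p L)" "x \<notin> L" by blast
    obtain r where r: "colon scale L (r *s x) \<in> Ass_quot scale L"
      using Ass_quot_colon_scale[OF L x(2)] by blast
    then have "x \<notin> saturation scale (colon scale L (r *s x)) L"
      unfolding notin_saturation_iff by (intro colon_subset_colon_scale[OF L])
    then show False using x(1) r by blast
  qed
qed

end

subsection \<open>Primary decomposition\<close>

definition primary_dec ::
    "('a::comm_ring_1 \<Rightarrow> 'b::ab_group_add \<Rightarrow> 'b) \<Rightarrow> 'b set \<Rightarrow> 'b set set \<Rightarrow> bool" where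
  "primary_dec scale L D \<longleftrightarrow> finite D \<and> (\<forall>Q\<in>D. primary_submod scale Q) \<and> \<Inter>D = L"

definition irreducible_submod ::
    "('a::comm_ring_1 \<Rightarrow> 'b::ab_group_add \<Rightarrow> 'b) \<Rightarrow> 'b set \<Rightarrow> bool" where
  "irreducible_submod scale L \<longleftrightarrow> module.subspace scale L \<and> L \<noteq> UNIV \<and>
    (\<forall>A B. module.subspace scale A \<longrightarrow> module.subspace scale B \<longrightarrow> A \<inter> B = L \<longrightarrow> A = L \<or> B = L)"

context module
begin

lemma min_primary_dec_imp_primary_dec: "min_primary_dec scale L D \<Longrightarrow> primary_dec scale L D"
  unfolding min_primary_dec_def primary_dec_def by blast

lemma primary_submod_subspace: "primary_submod scale Q \<Longrightarrow> subspace Q"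
  unfolding primary_submod_def by blast

lemma primary_submod_iff:
  "primary_submod scale Q \<longleftrightarrow> subspace Q \<and> Q \<noteq> UNIV \<and>
    (\<forall>r x. r *s x \<in> Q \<longrightarrow> x \<notin> Q \<longrightarrow> r \<in> primary_prime scale Q)"
  unfolding primary_submod_def primary_prime_def by blast

lemma primary_prime_UNIV [simp]: "primary_prime scale UNIV = UNIV"
  unfolding primary_prime_def by simp

lemma primary_prime_mono: "A \<subseteq> B \<Longrightarrow> primary_prime scale A \<subseteq> primary_prime scale B"
  unfolding primary_prime_def by blast

lemma primary_prime_subset_prime_colon:
  assumes "prime_ideal (colon scale L x)"
  shows "primary_prime scale L \<subseteq> colon scale L x"
proof
  fix r assume "r \<in> primary_prime scale L"
  then obtain n where "r ^ n \<in> colon scale L x" unfolding primary_prime_def by blast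
  then show "r \<in> colon scale L x" by (rule prime_ideal_powerD[OF assms])
qed

lemma primary_prime_Int:
  "primary_prime scale (A \<inter> B) = primary_prime scale A \<inter> primary_prime scale B"
proof
  show "primary_prime scale A \<inter> primary_prime scale B \<subseteq> primary_prime scale (A \<inter> B)"
  proof
    fix r assume "r \<in> primary_prime scale A \<inter> primary_prime scale B"
    then obtain n m where "\<And>y. r ^ n *s y \<in> A" "\<And>y. r ^ m *s y \<in> B"
      unfolding primary_prime_def by blast
    then have "r ^ n *s r ^ m *s y \<in> A" "r ^ m *s r ^ n *s y \<in> B" for y by blast+
    then have "\<forall>y. r ^ (n + m) *s y \<in> A \<inter> B" by (simp add: power_add mult.commute)
    then show "r \<in> primary_prime scale (A \<inter> B)" unfolding primary_prime_def by blast
  qed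
qed (simp_all add: primary_prime_mono)

lemma primary_prime_Inter:
  "finite D \<Longrightarrow> primary_prime scale (\<Inter>D) = (\<Inter>L\<in>D. primary_prime scale L)"
  by (induction D rule: finite_induct) (simp_all add: primary_prime_Int)

lemma primary_submod_Int:
  assumes "primary_submod scale A" "primary_submod scale B"
    and "primary_prime scale A = primary_prime scale B"
  shows "primary_submod scale (A \<inter> B)"
  using assms subspace_inter[of A B] unfolding primary_submod_iff primary_prime_Int by blast

lemma saturation_primary_submod:
  assumes P: "prime_ideal P" and Q: "primary_submod scale Q"
  shows "saturation scale P Q = (if primary_prime scale Q \<subseteq> P then Q else UNIV)"
proof (cases "primary_prime scale Q \<subseteq> P")
  case True
  then have "saturation scale P Q \<subseteq> Q" using Q unfolding saturation_def primary_submod_iff by blast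
  then show ?thesis using True saturation_superset[OF P, of Q] by auto
next
  case False
  then obtain r n where "r \<notin> P" "\<And>y. r ^ n *s y \<in> Q" unfolding primary_prime_def by blast
  then have "y \<in> saturation scale P Q" for y
    using prime_ideal_powerD[OF P] by (blast intro: saturationI)
  then show ?thesis using False by auto
qed

lemma saturation_primary_dec:
  assumes P: "prime_ideal P" and D: "primary_dec scale L D"
  shows "saturation scale P L = \<Inter>{Q \<in> D. primary_prime scale Q \<subseteq> P}"
proof -
  have "saturation scale P L = (\<Inter>Q\<in>D. saturation scale P Q)"
    using D saturation_Inter[OF P] primary_submod_subspace unfolding primary_dec_def by blast
  also have "\<dots> = (\<Inter>Q\<in>D. if primary_prime scale Q \<subseteq> P then Q else UNIV)"
    using D saturation_primary_submod[OF P] unfolding primary_dec_def by simp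
  also have "\<dots> = \<Inter>{Q \<in> D. primary_prime scale Q \<subseteq> P}" by auto
  finally show ?thesis .
qed

lemma primary_dec_merge:
  assumes D: "primary_dec scale L D" and AB: "A \<in> D" "B \<in> D" "A \<noteq> B"
    and eq: "primary_prime scale A = primary_prime scale B"
  obtains E where "primary_dec scale L E" "card E < card D"
proof
  let ?E = "insert (A \<inter> B) (D - {A, B})"
  have "primary_submod scale (A \<inter> B)"
    using D AB primary_submod_Int[OF _ _ eq] unfolding primary_dec_def by blast
  moreover have "\<Inter>?E = \<Inter>D" using AB by blast
  ultimately show "primary_dec scale L ?E" using D unfolding primary_dec_def by simp
  have "finite D" using D unfolding primary_dec_def by blast
  then have "card (insert A (insert B (D - {A, B}))) = Suc (Suc (card (D - {A, B})))"
    using \<open>A \<noteq> B\<close> by simp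
  moreover have "insert A (insert B (D - {A, B})) = D" using AB by blast
  moreover have "card ?E \<le> Suc (card (D - {A, B}))" using \<open>finite D\<close> by (simp add: card_insert_if)
  ultimately show "card ?E < card D" by simp
qed

lemma min_primary_dec_if_card_minimal:
  assumes D: "primary_dec scale L D" and minimal: "\<And>E. primary_dec scale L E \<Longrightarrow> card D \<le> card E"
  shows "min_primary_dec scale L D"
proof -
  have "inj_on (primary_prime scale) D"
  proof (intro inj_onI, rule ccontr)
    fix A B assume "A \<in> D" "B \<in> D" "primary_prime scale A = primary_prime scale B" "A \<noteq> B"
    then obtain E where "primary_dec scale L E" "card E < card D"
      using primary_dec_merge[OF D, of A B] by blast
    then show False using minimal[of E] by simp
  qed
  moreover have "\<Inter>(D - {Q}) \<noteq> L" if "Q \<in> D" for Q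
  proof
    assume "\<Inter>(D - {Q}) = L"
    then have "primary_dec scale L (D - {Q})" using D unfolding primary_dec_def by blast
    then have "card D \<le> card (D - {Q})" by (rule minimal)
    then show False using card_Diff1_less[of D Q] D that unfolding primary_dec_def by simp
  qed
  ultimately show ?thesis using D unfolding min_primary_dec_def primary_dec_def by blast
qed

end

context noetherian_module
begin

text \<open>Fitting's lemma for the endomorphism \<open>r\<close> of \<open>N/L\<close>.\<close>

lemma Fitting:
  assumes L: "subspace L"
  obtains n where "span (L \<union> range (scale (r ^ Suc n))) \<inter> scale (r ^ Suc n) -` L = L"
proof -
  let ?K = "\<lambda>n. scale (r ^ Suc n) -` L"
  obtain n where n: "\<forall>m\<in>UNIV. ?K n \<subseteq> ?K m \<longrightarrow> ?K m = ?K n"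
    by (rule maximal_subspace_indexed[of _ UNIV ?K]) (simp_all only: UNIV_I subspace_vimage_scale[OF L])
  define s where "s = r ^ Suc n"
  have s_square: "s * s = r ^ Suc (n + Suc n)" by (simp only: s_def add_Suc flip: power_add)
  have "scale s -` L \<subseteq> scale (s * s) -` L"
    using subspace_scale[OF L] by (auto simp flip: scale_scale)
  then have stable: "scale (s * s) -` L = scale s -` L" unfolding s_square using n unfolding s_def by blast
  have range_subspace: "subspace (range (scale s))"
    by (rule module_hom.subspace_image[OF module_hom_scale_self subspace_UNIV])
  have "span (L \<union> range (scale s)) \<inter> scale s -` L \<subseteq> L"
  proof
    fix z assume z: "z \<in> span (L \<union> range (scale s)) \<inter> scale s -` L"
    then obtain l y where ly: "z = l + s *s y" "l \<in> L"
      unfolding span_Un span_eq_iff[THEN iffD2, OF L] span_eq_iff[THEN iffD2, OF range_subspace]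
      by blast
    have "s *s z - s *s l \<in> L" using z subspace_diff[OF L] subspace_scale[OF L ly(2)] by simp
    then have "y \<in> scale (s * s) -` L" using ly(1) by (simp add: scale_right_distrib)
    then have "s *s y \<in> L" unfolding stable by simp
    then show "z \<in> L" using ly subspace_add[OF L] by simp
  qed
  moreover have "L \<subseteq> span (L \<union> range (scale s)) \<inter> scale s -` L"
    using subspace_scale[OF L] by (auto intro: span_base)
  ultimately show thesis using that[of n] unfolding s_def by blast
qed

lemma irreducible_imp_primary:
  assumes irr: "irreducible_submod scale L"
  shows "primary_submod scale L"
proof -
  have L: "subspace L" using irr unfolding irreducible_submod_def by blast
  have "r \<in> primary_prime scale L" if rx: "r *s x \<in> L" "x \<notin> L" for r x
  proof -
    obtain n where "span (L \<union> range (scale (r ^ Suc n))) \<inter> scale (r ^ Suc n) -` L = L"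
      by (rule Fitting[OF L])
    then have "span (L \<union> range (scale (r ^ Suc n))) = L \<or> scale (r ^ Suc n) -` L = L"
      using irr subspace_span subspace_vimage_scale[OF L] unfolding irreducible_submod_def by blast
    moreover have "r ^ Suc n *s x \<in> L"
      using subspace_scale[OF L rx(1), of "r ^ n"] by (simp add: mult.commute)
    then have "scale (r ^ Suc n) -` L \<noteq> L" using rx(2) by blast
    ultimately have "range (scale (r ^ Suc n)) \<subseteq> L"
      using span_superset[of "L \<union> range (scale (r ^ Suc n))"] by blast
    then show ?thesis unfolding primary_prime_def by blast
  qed
  then show ?thesis using irr unfolding primary_submod_iff irreducible_submod_def by blast
qed

lemma primary_dec_exists: "subspace L \<Longrightarrow> \<exists>D. primary_dec scale L D"
proof (induction L rule: noetherian_induct)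
  case (step L)
  consider (whole) "L = UNIV" | (irreducible) "irreducible_submod scale L"
    | (reducible) A B where "subspace A" "subspace B" "A \<inter> B = L" "A \<noteq> L" "B \<noteq> L"
    using step.hyps unfolding irreducible_submod_def by blast
  then show ?case
  proof cases
    case whole
    then have "primary_dec scale L {}" unfolding primary_dec_def by simp
    then show ?thesis by blast
  next
    case irreducible
    then have "primary_dec scale L {L}" unfolding primary_dec_def by (simp add: irreducible_imp_primary)
    then show ?thesis by blast
  next
    case reducible
    then obtain D E where "primary_dec scale A D" "primary_dec scale B E"
      using step.IH[of A] step.IH[of B] by blast
    then have "primary_dec scale L (D \<union> E)" using reducible(3) unfolding primary_dec_def by auto
    then show ?thesis by blast
  qed
qed

lemma min_primary_dec_exists: "subspace L \<Longrightarrow> \<exists>D. min_primary_dec scale L D"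
  using primary_dec_exists ex_has_least_nat[of "primary_dec scale L" _ card]
    min_primary_dec_if_card_minimal by metis

lemma primary_prime_in_Ass_quot:
  assumes D: "min_primary_dec scale L D" and Q: "Q \<in> D"
  shows "primary_prime scale Q \<in> Ass_quot scale L"
proof -
  have dec: "primary_dec scale L D" by (rule min_primary_dec_imp_primary_dec[OF D])
  then have primary_Q: "primary_submod scale Q" using Q unfolding primary_dec_def by blast
  let ?L' = "\<Inter>(D - {Q})"
  have subspaces: "subspace L" "subspace ?L'"
    using dec subspace_Inter[of D] subspace_Inter[of "D - {Q}"] primary_submod_subspace
    unfolding primary_dec_def by auto
  have inter: "?L' \<inter> Q = L" using dec Q unfolding primary_dec_def by blast
  then obtain x where x: "x \<in> ?L'" "x \<notin> L" using D Q unfolding min_primary_dec_def by blast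
  obtain s where s: "s *s x \<notin> L" "colon scale L (s *s x) \<in> Ass_quot scale L"
    by (rule Ass_quot_colon_scale[OF subspaces(1) x(2)])
  define y where "y = s *s x"
  have "y \<in> ?L'" unfolding y_def by (rule subspace_scale[OF subspaces(2) x(1)])
  then have "r *s y \<in> L \<longleftrightarrow> r *s y \<in> Q" for r using inter subspace_scale[OF subspaces(2)] by blast
  then have colon_eq: "colon scale L y = colon scale Q y" by simp
  then have "y \<notin> Q" using \<open>y \<in> ?L'\<close> inter s(1) unfolding y_def by blast
  then have "colon scale Q y \<subseteq> primary_prime scale Q"
    using primary_Q unfolding primary_submod_iff by blast
  moreover have "prime_ideal (colon scale Q y)"
    using Ass_quot_prime[OF s(2)] colon_eq unfolding y_def by simp
  then have "primary_prime scale Q \<subseteq> colon scale Q y" by (rule primary_prime_subset_prime_colon)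
  ultimately have "primary_prime scale Q = colon scale L y" unfolding colon_eq by (rule antisym[rotated])
  then show ?thesis using s(2) unfolding y_def by simp
qed

lemma min_Supp_below:
  assumes P: "P \<in> Supp scale"
  obtains q where "q \<in> min_Supp scale" "q \<subseteq> P"
proof -
  obtain D where D: "min_primary_dec scale {0} D"
    using min_primary_dec_exists[OF subspace_single_0] by blast
  let ?primes = "\<lambda>p. {q \<in> primary_prime scale ` D. q \<subseteq> p}"
  have nonempty: "?primes p \<noteq> {}" if p: "p \<in> Supp scale" for p
  proof
    assume "?primes p = {}"
    then have no_component: "{Q \<in> D. primary_prime scale Q \<subseteq> p} = {}" by blast
    have "saturation scale p {0} = UNIV"
      unfolding saturation_primary_dec[OF Supp_prime[OF p] min_primary_dec_imp_primary_dec[OF D]]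
        no_component by simp
    then show False using p unfolding Supp_iff_saturation by simp
  qed
  have "finite (?primes P)" using D unfolding min_primary_dec_def by simp
  then obtain q where q: "q \<in> ?primes P" "\<forall>p\<in>?primes P. p \<subseteq> q \<longrightarrow> q = p"
    using finite_has_minimal[OF _ nonempty[OF P]] by blast
  have "q \<in> Supp scale"
    using q(1) primary_prime_in_Ass_quot[OF D] Ass_quot_subset_Supp[OF subspace_single_0] by blast
  moreover have "p = q" if p: "p \<in> Supp scale" "p \<subseteq> q" for p
  proof -
    obtain p' where "p' \<in> ?primes p" using nonempty[OF p(1)] by blast
    then show ?thesis using q p(2) by blast
  qed
  ultimately show thesis using that[of q] q(1) unfolding min_Supp_def by blast
qed

subsection \<open>The theorems of Krull and Nakayama\<close>

lemma pow_submod_subset_if_subset_primary_prime: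
  assumes "subspace L" "I \<subseteq> primary_prime scale L"
  shows "\<exists>n. pow_submod scale I n \<subseteq> L"
  using assms
proof (induction L rule: noetherian_induct)
  case (step L)
  note L = \<open>subspace L\<close>
  show ?case
  proof (cases "L = UNIV")
    case False
    then obtain x where "x \<notin> L" by blast
    then obtain r where r: "r *s x \<notin> L" "colon scale L (r *s x) \<in> Ass_quot scale L"
      by (rule Ass_quot_colon_scale[OF L])
    define y where "y = r *s x"
    have I_y: "I \<subseteq> colon scale L y"
      using step.prems primary_prime_subset_prime_colon[OF Ass_quot_prime[OF r(2)]]
      unfolding y_def by blast
    let ?X = "span (insert y L)"
    have "L \<subseteq> ?X" "y \<in> ?X" by (auto intro: span_base)
    then obtain n where n: "pow_submod scale I n \<subseteq> ?X"
      using step.IH[OF subspace_span, of "insert y L"] step.prems primary_prime_mono[of L ?X] r(1)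
      unfolding y_def by blast
    have "?X \<subseteq> scale a -` L" if "a \<in> I" for a
      using I_y that subspace_scale[OF L]
      by (intro span_minimal[OF _ subspace_vimage_scale[OF L]]) auto
    then have "pow_submod scale I (Suc n) \<subseteq> L" unfolding pow_submod_Suc_subset_iff[OF L] using n by blast
    then show ?thesis by blast
  qed simp
qed

lemma subset_primary_prime_if_saturation_maximal:
  assumes P: "prime_ideal P" and L: "subspace L" and x: "x \<notin> saturation scale P L"
    and larger: "\<And>X. subspace X \<Longrightarrow> L \<subset> X \<Longrightarrow> x \<in> saturation scale P X"
  shows "P \<subseteq> primary_prime scale L"
proof
  have "A = L \<or> B = L" if AB: "subspace A" "subspace B" "A \<inter> B = L" for A B
  proof (rule ccontr)
    assume "\<not> (A = L \<or> B = L)"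
    then have "x \<in> saturation scale P A \<inter> saturation scale P B" using larger AB by blast
    then show False using x AB(3) saturation_Int[OF P AB(1,2)] by blast
  qed
  moreover have "L \<noteq> UNIV" using x saturation_UNIV[OF P] by blast
  ultimately have "irreducible_submod scale L" unfolding irreducible_submod_def using L by blast
  then have primary: "primary_submod scale L" by (rule irreducible_imp_primary)
  fix a assume "a \<in> P"
  have "a *s x \<in> L"
  proof (rule ccontr)
    assume "a *s x \<notin> L"
    then have "L \<subset> span (insert (a *s x) L)" by (auto intro: span_base)
    then have "x \<in> saturation scale P (span (insert (a *s x) L))" by (rule larger[OF subspace_span])
    then show False using x saturation_span_insert_scale[OF P L \<open>a \<in> P\<close>] by blast
  qed
  moreover have "x \<notin> L" using x saturation_superset[OF P] by blast
  ultimately show "a \<in> primary_prime scale L" using primary unfolding primary_submod_iff by blast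
qed

lemma Krull_intersection:
  assumes P: "prime_ideal P" and I: "I \<subseteq> P"
  shows "(\<Inter>n. saturation scale P (pow_submod scale I n)) \<subseteq> saturation scale P {0}"
proof
  fix x assume x: "x \<in> (\<Inter>n. saturation scale P (pow_submod scale I n))"
  have "x \<in> saturation scale P L" if "subspace L" for L
    using that
  proof (induction L rule: noetherian_induct)
    case (step L)
    show ?case
    proof (rule ccontr)
      assume notin: "x \<notin> saturation scale P L"
      then have "I \<subseteq> primary_prime scale L"
        using subset_primary_prime_if_saturation_maximal[OF P step.hyps] step.IH I by blast
      then obtain n where "pow_submod scale I n \<subseteq> L"
        using pow_submod_subset_if_subset_primary_prime[OF step.hyps] by blast
      then show False using x notin saturation_mono by blast
    qed
  qed
  then show "x \<in> saturation scale P {0}" by simp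
qed

lemma saturation_pow_submod_UNIV:
  assumes P: "prime_ideal P" and "saturation scale P (pow_submod scale I 1) = UNIV"
  shows "saturation scale P (pow_submod scale I n) = UNIV"
proof -
  obtain u where u: "u \<notin> P" "saturation scale P (pow_submod scale I 1) = scale u -` pow_submod scale I 1"
    by (rule saturation_uniform[OF P subspace_pow_submod])
  have "u ^ n *s x \<in> pow_submod scale I n" for x
  proof (induction n arbitrary: x)
    case (Suc n)
    have "pow_submod scale I (Suc 0) \<subseteq> scale (u ^ n) -` pow_submod scale I (Suc n)"
      unfolding pow_submod_Suc_subset_iff[OF subspace_vimage_scale[OF subspace_pow_submod]]
      using scale_mem_pow_submod_Suc[OF _ Suc.IH] by (simp add: mult.commute)
    moreover have "u *s x \<in> pow_submod scale I (Suc 0)" using u(2) assms(2) by auto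
    ultimately have "u ^ n *s u *s x \<in> pow_submod scale I (Suc n)" by blast
    then show ?case by (simp add: mult.commute)
  qed simp
  moreover have "u ^ n \<notin> P" using u(1) prime_ideal_powerD[OF P] by blast
  ultimately show ?thesis using saturationI by blast
qed

lemma Nakayama:
  assumes "P \<in> Supp scale" "I \<subseteq> P"
  shows "saturation scale P (pow_submod scale I 1) \<noteq> UNIV"
proof
  have P: "prime_ideal P" "saturation scale P {0} \<noteq> UNIV" using assms(1) Supp_iff_saturation by auto
  assume "saturation scale P (pow_submod scale I 1) = UNIV"
  then have "saturation scale P (pow_submod scale I n) = UNIV" for n
    by (rule saturation_pow_submod_UNIV[OF P(1)])
  then show False using Krull_intersection[OF P(1) assms(2)] P(2) by auto
qed

lemma Ass_quot_pow_submod_below: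
  assumes "P \<in> Supp scale" "I \<subseteq> P"
  obtains p where "p \<in> Ass_quot scale (pow_submod scale I 1)" "p \<subseteq> P"
  by (rule Ass_quot_below[OF Supp_prime[OF assms(1)] subspace_pow_submod Nakayama[OF assms] that])

lemma N_proper_if_subset_Supp: "P \<in> Supp scale \<Longrightarrow> I \<subseteq> P \<Longrightarrow> N_proper scale I"
  using Nakayama[of P I] saturation_UNIV[OF Supp_prime] unfolding N_proper_def by metis

subsection \<open>Symbolic powers\<close>

lemma min_Ass_quot_pow_submod_minimal:
  assumes p: "p \<in> min_Ass_quot scale (pow_submod scale I 1)"
    and P: "P \<in> Supp scale" "I \<subseteq> P" "P \<subseteq> p"
  shows "P = p"
proof -
  obtain q where "q \<in> Ass_quot scale (pow_submod scale I 1)" "q \<subseteq> P"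
    by (rule Ass_quot_pow_submod_below[OF P(1,2)])
  then show ?thesis using p P(3) unfolding min_Ass_quot_def by blast
qed

lemma symb_power_eq_Inter_saturation:
  "symb_power scale I n =
    (\<Inter>p\<in>min_Ass_quot scale (pow_submod scale I 1). saturation scale p (pow_submod scale I n))"
proof -
  let ?L = "pow_submod scale I n" and ?M = "min_Ass_quot scale (pow_submod scale I 1)"
  define D where "D = (SOME D. min_primary_dec scale ?L D)"
  have D: "min_primary_dec scale ?L D"
    unfolding D_def by (rule someI_ex[OF min_primary_dec_exists[OF subspace_pow_submod]])
  have "saturation scale p ?L = \<Inter>{Q \<in> D. primary_prime scale Q = p}" if p: "p \<in> ?M" for p
  proof -
    have "primary_prime scale Q = p" if Q: "Q \<in> D" "primary_prime scale Q \<subseteq> p" for Q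
    proof -
      have Ass: "primary_prime scale Q \<in> Ass_quot scale ?L"
        by (rule primary_prime_in_Ass_quot[OF D Q(1)])
      then have "primary_prime scale Q \<in> Supp scale"
        using Ass_quot_subset_Supp[OF subspace_pow_submod] by blast
      then show ?thesis
        using min_Ass_quot_pow_submod_minimal[OF p] Ass_quot_pow_submod_contains[OF Ass] Q(2) by blast
    qed
    then have "{Q \<in> D. primary_prime scale Q \<subseteq> p} = {Q \<in> D. primary_prime scale Q = p}" by blast
    moreover have "prime_ideal p" using p Ass_quot_prime unfolding min_Ass_quot_def by blast
    ultimately show ?thesis
      using saturation_primary_dec min_primary_dec_imp_primary_dec[OF D] by simp
  qed
  then have "(\<Inter>p\<in>?M. saturation scale p ?L) = \<Inter>{Q \<in> D. primary_prime scale Q \<in> ?M}" by auto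
  then show ?thesis unfolding symb_power_def Let_def D_def[symmetric] by simp
qed

lemma min_Ass_quot_prime_pow_submod:
  assumes P: "P \<in> Supp scale"
  shows "min_Ass_quot scale (pow_submod scale P 1) = {P}"
proof -
  obtain p where p: "p \<in> Ass_quot scale (pow_submod scale P 1)" "p \<subseteq> P"
    by (rule Ass_quot_pow_submod_below[OF P order_refl])
  have contains_P: "\<forall>q\<in>Ass_quot scale (pow_submod scale P 1). P \<subseteq> q"
    using Ass_quot_pow_submod_contains by blast
  then have "P \<in> Ass_quot scale (pow_submod scale P 1)" using p by auto
  then show ?thesis using contains_P unfolding min_Ass_quot_def by (auto intro: antisym)
qed

lemma symb_power_prime:
  "P \<in> Supp scale \<Longrightarrow> symb_power scale P n = saturation scale P (pow_submod scale P n)"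
  unfolding symb_power_eq_Inter_saturation by (simp add: min_Ass_quot_prime_pow_submod del: One_nat_def)

lemma symb_power_subset_if_unmixed:
  assumes "Ass_quot scale (pow_submod scale I n) \<subseteq> min_Ass_quot scale (pow_submod scale I 1)"
  shows "symb_power scale I n \<subseteq> pow_submod scale I n"
proof -
  have "symb_power scale I n
      \<subseteq> (\<Inter>p\<in>Ass_quot scale (pow_submod scale I n). saturation scale p (pow_submod scale I n))"
    unfolding symb_power_eq_Inter_saturation using assms by (rule INT_anti_mono) simp
  then show ?thesis unfolding Inter_saturation_Ass_quot[OF subspace_pow_submod] .
qed

subsection \<open>Linear equivalence and local associated primes\<close>

lemma saturation_0_subset_if_lin_equiv:
  assumes Q: "Q \<in> Supp scale" "lin_equiv_topologies scale Q" and P: "prime_ideal P" "Q \<subseteq> P"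
  shows "saturation scale Q {0} \<subseteq> saturation scale P {0}"
proof -
  obtain k where k: "\<And>n. symb_power scale Q (n + k) \<subseteq> pow_submod scale Q n"
    using Q(2) unfolding lin_equiv_topologies_def by blast
  have "saturation scale Q {0} \<subseteq> saturation scale P (pow_submod scale Q n)" for n
  proof -
    have "saturation scale Q {0} \<subseteq> symb_power scale Q (n + k)"
      unfolding symb_power_prime[OF Q(1)]
      by (intro saturation_mono) (simp add: subspace_0[OF subspace_pow_submod])
    also have "\<dots> \<subseteq> pow_submod scale Q n" by (rule k)
    also have "\<dots> \<subseteq> saturation scale P (pow_submod scale Q n)" by (rule saturation_superset[OF P(1)])
    finally show ?thesis .
  qed
  then show ?thesis using Krull_intersection[OF P] by blast
qed

lemma loc_Ass_singleton_if_lin_equiv: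
  assumes lin_equiv: "\<And>Q. Q \<in> Supp scale \<Longrightarrow> lin_equiv_topologies scale Q"
    and P: "P \<in> Supp scale"
  shows "\<exists>q. loc_Ass scale P = {q}"
proof -
  have prime_P: "prime_ideal P" by (rule Supp_prime[OF P])
  obtain q where q: "q \<in> min_Supp scale" "q \<subseteq> P" by (rule min_Supp_below[OF P])
  have q_Supp: "q \<in> Supp scale" and q_min: "\<And>p. p \<in> Supp scale \<Longrightarrow> p \<subseteq> q \<Longrightarrow> p = q"
    using q(1) unfolding min_Supp_def by auto
  have Ass_Supp: "Ass_quot scale {0} \<subseteq> Supp scale" by (rule Ass_quot_subset_Supp[OF subspace_single_0])
  have "p = q" if p: "p \<in> Ass_quot scale {0}" "p \<subseteq> P" for p
  proof -
    obtain x where x: "p = colon scale {0} x" using p(1) unfolding Ass_quot_def by blast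
    then have "x \<notin> saturation scale P {0}" using p(2) unfolding notin_saturation_iff by simp
    then have "x \<notin> saturation scale q {0}"
      using saturation_0_subset_if_lin_equiv[OF q_Supp lin_equiv[OF q_Supp] prime_P q(2)] by blast
    then have "p \<subseteq> q" unfolding x notin_saturation_iff .
    then show ?thesis using q_min p(1) Ass_Supp by blast
  qed
  moreover obtain p where "p \<in> Ass_quot scale {0}" "p \<subseteq> P" by (rule Supp_Ass_below[OF P])
  ultimately have "loc_Ass scale P = {q}" unfolding loc_Ass_eq[OF prime_P] by blast
  then show ?thesis by blast
qed

subsection \<open>Linear equivalence and dimension\<close>

lemma power_scale_in_symb_power_mult_image:
  assumes P: "P \<in> Supp scale" "a \<in> P" "P \<subset> J"
  shows "a ^ n *s x \<in> symb_power scale ((*) a ` J) n"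
  unfolding symb_power_eq_Inter_saturation
proof
  fix p assume p: "p \<in> min_Ass_quot scale (pow_submod scale ((*) a ` J) 1)"
  have "(*) a ` J \<subseteq> P" using P(2) prime_ideal_mult_iff[OF Supp_prime[OF P(1)]] by blast
  then have "\<not> J \<subseteq> p" using min_Ass_quot_pow_submod_minimal[OF p P(1)] P(3) by blast
  then obtain s where s: "s \<in> J" "s \<notin> p" by blast
  have "prime_ideal p" using p Ass_quot_prime unfolding min_Ass_quot_def by blast
  then have "s ^ n \<notin> p" using s(2) prime_ideal_powerD by blast
  moreover have "(a * s) ^ n *s x \<in> pow_submod scale ((*) a ` J) n"
    using s(1) by (intro power_scale_mem_pow_submod) blast
  then have "s ^ n *s a ^ n *s x \<in> pow_submod scale ((*) a ` J) n"
    by (simp add: power_mult_distrib mult.commute)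
  ultimately show "a ^ n *s x \<in> saturation scale p (pow_submod scale ((*) a ` J) n)"
    by (rule saturationI)
qed

lemma saturation_cancel_power_nonzerodivisor:
  assumes P: "prime_ideal P" and a: "\<And>p. p \<in> loc_Ass scale P \<Longrightarrow> a \<notin> p"
    and "a ^ n *s x \<in> saturation scale P {0}"
  shows "x \<in> saturation scale P {0}"
proof (rule ccontr)
  assume "x \<notin> saturation scale P {0}"
  then obtain p where p: "p \<in> loc_Ass scale P" "a ^ n \<in> p"
    using zero_divisor_in_Ass_quot[OF subspace_saturation[OF P subspace_single_0] assms(3)]
    unfolding loc_Ass_eq_Ass_quot_saturation[OF P] by blast
  have "prime_ideal p" using p(1) unfolding loc_Ass_def by blast
  then show False using a p prime_ideal_powerD by blast
qed

lemma saturation_0_UNIV_if_power_scale_mem: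
  assumes P: "prime_ideal P" and a: "\<And>p. p \<in> loc_Ass scale P \<Longrightarrow> a \<notin> p"
    and power_scale_mem: "\<And>n x. a ^ (n + k) *s x \<in> scale (a ^ n) ` pow_submod scale P n"
  shows "saturation scale P {0} = UNIV"
proof -
  have "a ^ k *s x \<in> saturation scale P (pow_submod scale P n)" for n x
  proof -
    obtain y where y: "y \<in> pow_submod scale P n" "a ^ (n + k) *s x = a ^ n *s y"
      using power_scale_mem[of n x] by blast
    then have "a ^ n *s (a ^ k *s x - y) = 0" by (simp add: scale_right_diff_distrib power_add)
    then have "a ^ n *s (a ^ k *s x - y) \<in> saturation scale P {0}"
      using saturation_superset[OF P] by auto
    then have "a ^ k *s x - y \<in> saturation scale P {0}"
      using saturation_cancel_power_nonzerodivisor[OF P a] by blast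
    then have "a ^ k *s x - y \<in> saturation scale P (pow_submod scale P n)"
      using saturation_mono[of "{0}" "pow_submod scale P n"] subspace_0[OF subspace_pow_submod] by auto
    then have "a ^ k *s x - y + y \<in> saturation scale P (pow_submod scale P n)"
      using subspace_add[OF subspace_saturation[OF P subspace_pow_submod]]
        saturation_superset[OF P] y(1) by blast
    then show ?thesis by simp
  qed
  then have "a ^ k *s x \<in> saturation scale P {0}" for x
    using Krull_intersection[OF P order_refl] by blast
  then show ?thesis using saturation_cancel_power_nonzerodivisor[OF P a] by blast
qed

lemma dim_le_one_if_lin_equiv:
  assumes lin_equiv: "\<And>I. is_ideal I \<Longrightarrow> N_proper scale I \<Longrightarrow> lin_equiv_topologies scale I"
    and single: "\<And>P. P \<in> Supp scale \<Longrightarrow> \<exists>q. loc_Ass scale P = {q}"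
  shows "dim_le_one scale"
  unfolding dim_le_one_def
proof (intro notI, elim exE conjE)
  fix P0 P1 P2
  assume Supp: "P0 \<in> Supp scale" "P1 \<in> Supp scale" "P2 \<in> Supp scale" and chain: "P0 \<subset> P1" "P1 \<subset> P2"
  have P2: "prime_ideal P2" by (rule Supp_prime[OF Supp(3)])
  obtain a where a: "a \<in> P1" "a \<notin> P0" using chain(1) by blast
  let ?I = "(*) a ` P2"
  have "is_ideal ?I" by (rule is_ideal_mult_image[OF prime_ideal_is_ideal[OF P2]])
  moreover have "?I \<subseteq> P1" using a(1) prime_ideal_mult_iff[OF Supp_prime[OF Supp(2)]] by blast
  then have "N_proper scale ?I" by (rule N_proper_if_subset_Supp[OF Supp(2)])
  ultimately obtain k where k: "\<And>n. symb_power scale ?I (n + k) \<subseteq> pow_submod scale ?I n"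
    using lin_equiv unfolding lin_equiv_topologies_def by blast
  have "a ^ (n + k) *s x \<in> scale (a ^ n) ` pow_submod scale P2 n" for n x
    using power_scale_in_symb_power_mult_image[OF Supp(2) a(1) chain(2)] k
      pow_submod_mult_image_subset by blast
  moreover have "a \<notin> q" if q: "q \<in> loc_Ass scale P2" for q
  proof -
    obtain p where p: "p \<in> Ass_quot scale {0}" "p \<subseteq> P0" by (rule Supp_Ass_below[OF Supp(1)])
    then have "p \<in> loc_Ass scale P2" unfolding loc_Ass_eq[OF P2] using chain by blast
    then have "q = p" using single[OF Supp(3)] q by blast
    then show ?thesis using p(2) a(2) by blast
  qed
  ultimately have "saturation scale P2 {0} = UNIV"
    by (intro saturation_0_UNIV_if_power_scale_mem[OF P2])
  then show False using Supp(3) unfolding Supp_iff_saturation by blast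
qed

subsection \<open>Unmixed powers in dimension one\<close>

lemma pow_submod_subset_components:
  assumes D: "primary_dec scale L D"
  shows "\<exists>n. pow_submod scale I n \<subseteq> \<Inter>{Q \<in> D. I \<subseteq> primary_prime scale Q}"
proof (rule pow_submod_subset_if_subset_primary_prime)
  let ?E = "{Q \<in> D. I \<subseteq> primary_prime scale Q}"
  show "subspace (\<Inter>?E)"
    using D primary_submod_subspace unfolding primary_dec_def by (intro subspace_Inter) simp
  have "finite ?E" using D unfolding primary_dec_def by simp
  then show "I \<subseteq> primary_prime scale (\<Inter>?E)" by (auto simp: primary_prime_Inter)
qed

lemma pow_submod_subset_saturation_0:
  assumes D: "min_primary_dec scale {0} D" and P: "prime_ideal P"
    and components: "pow_submod scale I n \<subseteq> \<Inter>{Q \<in> D. I \<subseteq> primary_prime scale Q}"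
    and contains: "\<And>p. p \<in> loc_Ass scale P \<Longrightarrow> I \<subseteq> p"
  shows "pow_submod scale I n \<subseteq> saturation scale P {0}"
proof -
  have "pow_submod scale I n \<subseteq> Q" if Q: "Q \<in> D" "primary_prime scale Q \<subseteq> P" for Q
  proof -
    have "primary_prime scale Q \<in> loc_Ass scale P"
      unfolding loc_Ass_eq[OF P] using primary_prime_in_Ass_quot[OF D Q(1)] Q(2) by blast
    then show ?thesis using contains components Q(1) by blast
  qed
  then show ?thesis
    unfolding saturation_primary_dec[OF P min_primary_dec_imp_primary_dec[OF D]] by blast
qed

lemma Ass_quot_imp_loc_Ass:
  assumes p: "p \<in> Ass_quot scale L" and L: "subspace L" "L \<subseteq> saturation scale p {0}"
  shows "p \<in> loc_Ass scale p"
proof -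
  have prime_p: "prime_ideal p" by (rule Ass_quot_prime[OF p])
  have "saturation scale p L \<subseteq> saturation scale p {0}"
    using saturation_mono[OF L(2)] saturation_idem[OF prime_p] by blast
  moreover have "saturation scale p {0} \<subseteq> saturation scale p L"
    using subspace_0[OF L(1)] by (intro saturation_mono) simp
  ultimately have "loc_Ass scale p = Ass_quot scale (saturation scale p L)"
    unfolding loc_Ass_eq_Ass_quot_saturation[OF prime_p] by simp
  then show ?thesis using p unfolding Ass_quot_saturation[OF prime_p L(1)] by simp
qed

lemma Ass_quot_pow_submod_unmixed:
  assumes dim: "dim_le_one scale"
    and single: "\<And>P. P \<in> Supp scale \<Longrightarrow> \<exists>q. loc_Ass scale P = {q}"
    and D: "min_primary_dec scale {0} D"
    and components: "pow_submod scale I n \<subseteq> \<Inter>{Q \<in> D. I \<subseteq> primary_prime scale Q}"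
  shows "Ass_quot scale (pow_submod scale I n) \<subseteq> min_Ass_quot scale (pow_submod scale I 1)"
proof (rule subsetI, rule ccontr)
  fix p assume p: "p \<in> Ass_quot scale (pow_submod scale I n)"
    and not_min: "p \<notin> min_Ass_quot scale (pow_submod scale I 1)"
  have prime_p: "prime_ideal p" by (rule Ass_quot_prime[OF p])
  have p_Supp: "p \<in> Supp scale" using p Ass_quot_subset_Supp[OF subspace_pow_submod] by blast
  obtain q' where "q' \<in> Ass_quot scale (pow_submod scale I 1)" "q' \<subseteq> p"
    by (rule Ass_quot_pow_submod_below[OF p_Supp Ass_quot_pow_submod_contains[OF p]])
  then obtain q where q: "q \<in> Ass_quot scale (pow_submod scale I 1)" "q \<subset> p"
    using not_min unfolding min_Ass_quot_def by blast
  have q_Supp: "q \<in> Supp scale" using q(1) Ass_quot_subset_Supp[OF subspace_pow_submod] by blast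
  obtain q0 where q0: "q0 \<in> Ass_quot scale {0}" "q0 \<subseteq> q" by (rule Supp_Ass_below[OF q_Supp])
  have "q0 \<in> Supp scale" using q0(1) Ass_quot_subset_Supp[OF subspace_single_0] by blast
  then have "q0 = q" using dim q_Supp p_Supp q0(2) q(2) unfolding dim_le_one_def by blast
  then have "q \<in> loc_Ass scale p" unfolding loc_Ass_eq[OF prime_p] using q0(1) q(2) by blast
  then have loc_Ass_p: "loc_Ass scale p = {q}" using single[OF p_Supp] by blast
  have "pow_submod scale I n \<subseteq> saturation scale p {0}"
    using loc_Ass_p Ass_quot_pow_submod_contains[OF q(1)]
    by (intro pow_submod_subset_saturation_0[OF D prime_p components]) simp
  then have "p \<in> loc_Ass scale p" by (rule Ass_quot_imp_loc_Ass[OF p subspace_pow_submod])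
  then show False using loc_Ass_p q(2) by blast
qed

lemma lin_equiv_if_dim_le_one:
  assumes "dim_le_one scale" "\<And>P. P \<in> Supp scale \<Longrightarrow> \<exists>q. loc_Ass scale P = {q}"
  shows "lin_equiv_topologies scale I"
proof -
  obtain D where D: "min_primary_dec scale {0} D"
    using min_primary_dec_exists[OF subspace_single_0] by blast
  obtain k where k: "pow_submod scale I k \<subseteq> \<Inter>{Q \<in> D. I \<subseteq> primary_prime scale Q}"
    using pow_submod_subset_components[OF min_primary_dec_imp_primary_dec[OF D]] by blast
  have "symb_power scale I (n + k) \<subseteq> pow_submod scale I n" for n
  proof -
    have "pow_submod scale I (n + k) \<subseteq> pow_submod scale I k" by (rule pow_submod_antimono) simp
    then have "symb_power scale I (n + k) \<subseteq> pow_submod scale I (n + k)"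
      using k by (intro symb_power_subset_if_unmixed Ass_quot_pow_submod_unmixed[OF assms D]) auto
    also have "\<dots> \<subseteq> pow_submod scale I n" by (rule pow_submod_antimono) simp
    finally show ?thesis .
  qed
  then show ?thesis unfolding lin_equiv_topologies_def by blast
qed

end

theorem theorem2p4:
  fixes scale :: "'a::comm_ring_1 \<Rightarrow> 'b::ab_group_add \<Rightarrow> 'b"
  assumes "noetherian_ring TYPE('a)"
    and "module scale"
    and "fin_gen_module scale"
    and "(UNIV :: 'b set) \<noteq> {0}"
  shows "(\<forall>I::'a set. is_ideal I \<and> N_proper scale I \<longrightarrow> lin_equiv_topologies scale I)
     \<longleftrightarrow> (dim_le_one scale \<and> (\<forall>P \<in> Supp scale. \<exists>Q. loc_Ass scale P = {Q}))"
proof -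
  interpret noetherian_module scale by (rule noetherian_moduleI[OF assms(1-3)])
  show ?thesis
  proof
    assume lin_equiv: "\<forall>I::'a set. is_ideal I \<and> N_proper scale I \<longrightarrow> lin_equiv_topologies scale I"
    have "lin_equiv_topologies scale P" if "P \<in> Supp scale" for P
      using lin_equiv prime_ideal_is_ideal[OF Supp_prime[OF that]]
        N_proper_if_subset_Supp[OF that order_refl] by blast
    then have single: "\<exists>Q. loc_Ass scale P = {Q}" if "P \<in> Supp scale" for P
      by (rule loc_Ass_singleton_if_lin_equiv[OF _ that])
    then have "dim_le_one scale" by (intro dim_le_one_if_lin_equiv) (simp_all add: lin_equiv)
    then show "dim_le_one scale \<and> (\<forall>P \<in> Supp scale. \<exists>Q. loc_Ass scale P = {Q})" using single by simp
  next
    assume "dim_le_one scale \<and> (\<forall>P \<in> Supp scale. \<exists>Q. loc_Ass scale P = {Q})"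
    then show "\<forall>I::'a set. is_ideal I \<and> N_proper scale I \<longrightarrow> lin_equiv_topologies scale I"
      by (intro allI impI lin_equiv_if_dim_le_one) simp_all
  qed
qed

end
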